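(* Let $\mathbb{K}\in\{\mathbb{R},\mathbb{C},\mathbb{H},\mathbb{O}\}$, $\ell=\dim_{\mathbb{R}}\mathbb{K}$, and let $a_1,\dots,a_\ell\in\mathbb{K}$ be a system of simple roots of a finite-type root system in $\mathbb{K}$, with highest root $\theta$, normalized so that $\theta\bar\theta=1$. Let $\varepsilon_i=a_i/\sqrt{N(a_i)}$. Define $$S_0=\begin{pmatrix}0&\theta\\-\bar\theta&1\end{pmatrix},\qquad S_i=\begin{pmatrix}0&-\varepsilon_i\\\bar\varepsilon_i&0\end{pmatrix}\quad(i=1,\dots,\ell).$$ Let $w_{-1},w_0,\dots,w_\ell$ be the simple reflections of the hyperbolic root lattice $\Lambda$ (defined in the context), and let $s_0=w_{-1}w_0$ and $s_i=w_{-1}w_i$ for $i=1,\dots,\ell$ be the double reflections generating the even Weyl group. Then for all $X\in\Lambda$ $$s_I(X)=S_I\,X\,S_I^\dagger,\qquad I=0,1,\dots,\ell.$$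
   Context: $\mathbb{K}$ is one of the four normed division algebras over $\mathbb{R}$, with conjugation $a\mapsto\bar a$, norm $N(a)=a\bar a$, and positive definite form $(a,b)=a\bar b+b\bar a$. $a_1,\dots,a_\ell$ being simple roots of finite type means that $\big[2(a_i,a_j)/(a_j,a_j)\big]$ is the Cartan matrix of a finite root system; $Q=\sum_i\mathbb{Z}a_i$. $H_2(\mathbb{K})$ is the space of Hermitian matrices $X=\begin{pmatrix}x^+&z\\\bar z&x^-\end{pmatrix}$, $x^\pm\in\mathbb{R}$, $z\in\mathbb{K}$, with $\|X\|^2=-2\det X=-2(x^+x^--z\bar z)$ and $(X,Y)=\tfrac12(\|X+Y\|^2-\|X\|^2-\|Y\|^2)$. The hyperbolic root lattice is $\Lambda=\{X\in H_2(\mathbb{K}): x^\pm\in\mathbb{Z},\ z\in Q\}$, with simple roots $$\alpha_{-1}=\begin{pmatrix}1&0\\0&-1\end{pmatrix},\quad \alpha_0=\begin{pmatrix}-1&-\theta\\-\bar\theta&0\end{pmatrix},\quad \alpha_i=\begin{pmatrix}0&a_i\\\bar a_i&0\end{pmatrix}\ (1\le i\le\ell),$$ and simple reflections $w_I(X)=X-\frac{2(X,\alpha_I)}{(\alpha_I,\alpha_I)}\alpha_I$, $I=-1,0,\dots,\ell$. $M^\dagger$ is the conjugate transpose. For $\mathbb{K}=\mathbb{O}$ the triple product $S_IXS_I^\dagger$ is read with either choice of bracketing (it is unambiguous since $\mathbb{O}$ is alternative and only two non-real octonions, up to conjugation, are involved). *)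

theory Defs
  imports "HOL-Analysis.Analysis"
begin

section \<open>Normed division algebras\<close>

text \<open>Multiplication is not assumed associative, so the library's classes of normed algebras do
  not apply. By Hurwitz's theorem the models of this class are, up to isomorphism, exactly the
  reals, complex numbers, quaternions and octonions; all four are shown to be instances below.\<close>

class normed_division_algebra = euclidean_space + times + one +
  assumes nda_distrib_right: "(a + b) * c = a * c + b * c"
    and nda_distrib_left: "a * (b + c) = a * b + a * c"
    and nda_scaleR_left: "(r *\<^sub>R a) * b = r *\<^sub>R (a * b)"
    and nda_scaleR_right: "a * (r *\<^sub>R b) = r *\<^sub>R (a * b)"
    and nda_one_left [simp]: "1 * a = a"
    and nda_one_right [simp]: "a * 1 = a"
    and nda_norm_mult: "norm (a * b) = norm a * norm b"

class normed_division_algebra_assoc = normed_division_algebra +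
  assumes nda_assoc: "(a * b) * c = a * (b * c)"

class normed_division_algebra_comm = normed_division_algebra_assoc +
  assumes nda_commute: "a * b = b * a"

instance real :: normed_division_algebra_comm
  by standard (auto simp: algebra_simps abs_mult)

instance complex :: normed_division_algebra_comm
  by standard (auto simp: algebra_simps norm_mult)

definition re_part :: "'k::normed_division_algebra \<Rightarrow> real" where
  "re_part x = inner x 1"

definition cjg :: "'k::normed_division_algebra \<Rightarrow> 'k" where
  "cjg x = (2 * re_part x) *\<^sub>R 1 - x"

text \<open>The elements \<open>a * cjg a\<close> and \<open>a * cjg b + b * cjg a\<close> are real multiples of \<open>1\<close>
  (lemmas \<open>mult_cjg\<close> and \<open>form_eq\<close> below); \<open>re_part\<close> only identifies the line spanned by \<open>1\<close>
  with the type \<^typ>\<open>real\<close>.\<close>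

definition nrm :: "'k::normed_division_algebra \<Rightarrow> real" where
  "nrm a = re_part (a * cjg a)"

definition form :: "'k::normed_division_algebra \<Rightarrow> 'k \<Rightarrow> real" where
  "form a b = re_part (a * cjg b + b * cjg a)"

lemma cjg_real [simp]: "cjg (x::real) = x"
  by (simp add: cjg_def re_part_def)

lemma cjg_complex [simp]: "cjg (z::complex) = cnj z"
  by (simp add: cjg_def re_part_def inner_complex_def complex_eq_iff)

lemma nda_minus_left: "(- a) * b = - (a * b :: 'k::normed_division_algebra)"
  using nda_scaleR_left[of "-1" a b] by simp

lemma nda_minus_right: "a * (- b) = - (a * b :: 'k::normed_division_algebra)"
  using nda_scaleR_right[of a "-1" b] by simp

lemma nda_diff_left: "(a - c) * b = (a * b - c * b :: 'k::normed_division_algebra)"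
  using nda_distrib_right[of a "- c" b] by (simp add: nda_minus_left)

lemma nda_diff_right: "a * (b - c) = (a * b - a * c :: 'k::normed_division_algebra)"
  using nda_distrib_left[of a b "- c"] by (simp add: nda_minus_right)

lemma nda_zero_left [simp]: "0 * a = (0 :: 'k::normed_division_algebra)"
  using nda_scaleR_left[of 0 a a] by simp

lemma nda_zero_right [simp]: "a * 0 = (0 :: 'k::normed_division_algebra)"
  using nda_scaleR_right[of a 0 a] by simp

lemmas nda_bilinear = nda_distrib_left nda_distrib_right nda_diff_left nda_diff_right
  nda_minus_left nda_minus_right nda_scaleR_left nda_scaleR_right

lemma nda_norm_one: "norm (1::'k::normed_division_algebra) = 1"
proof -
  obtain u :: 'k where u: "u \<in> Basis" using nonempty_Basis by blast
  have "norm (1 * u) = norm (1::'k) * norm u" by (rule nda_norm_mult)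
  then show ?thesis using u by simp
qed

lemma inner_one_one [simp]: "inner (1::'k::normed_division_algebra) 1 = 1"
  using nda_norm_one[where 'k='k] by (simp add: norm_eq_1)

lemma cjg_cjg [simp]: "cjg (cjg x) = x"
  by (simp add: cjg_def re_part_def inner_diff_left)

lemma cjg_add: "cjg (x + y) = cjg x + cjg y"
  and cjg_diff: "cjg (x - y) = cjg x - cjg y"
  and cjg_minus: "cjg (- x) = - cjg x"
  by (simp_all add: cjg_def re_part_def inner_add_left inner_diff_left algebra_simps)

lemma inner_cjg_left: "inner (cjg x) y = inner x (cjg y)"
  by (simp add: cjg_def re_part_def inner_diff_left inner_diff_right inner_commute)

lemma inner_mult_same_left: "inner (x * y) (x * z) = (norm x)\<^sup>2 * inner y z"
  for x y z :: "'k::normed_division_algebra"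
proof -
  have n: "inner (x * w) (x * w) = (norm x)\<^sup>2 * inner w w" for w
    using nda_norm_mult[of x w] by (simp add: dot_square_norm power_mult_distrib)
  show ?thesis
    using n[of "y + z"] n[of y] n[of z]
    by (simp add: nda_distrib_left inner_add_left inner_add_right inner_commute algebra_simps)
qed

lemma inner_mult_same_right: "inner (y * x) (z * x) = (norm x)\<^sup>2 * inner y z"
  for x y z :: "'k::normed_division_algebra"
proof -
  have n: "inner (w * x) (w * x) = (norm x)\<^sup>2 * inner w w" for w
    using nda_norm_mult[of w x] by (simp add: dot_square_norm power_mult_distrib)
  show ?thesis
    using n[of "y + z"] n[of y] n[of z]
    by (simp add: nda_distrib_right inner_add_left inner_add_right inner_commute algebra_simps)
qed

lemma inner_mult_exchange_left:
  "inner (x * y) (u * z) + inner (u * y) (x * z) = 2 * inner x u * inner y z"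
  for x y z :: "'k::normed_division_algebra"
  using inner_mult_same_left[of "x + u" y z] inner_mult_same_left[of x y z]
    inner_mult_same_left[of u y z]
  by (simp add: nda_distrib_right inner_add_left inner_add_right inner_commute
      power2_norm_eq_inner algebra_simps)

lemma inner_mult_exchange_right:
  "inner (y * x) (z * u) + inner (y * u) (z * x) = 2 * inner x u * inner y z"
  for x y z :: "'k::normed_division_algebra"
  using inner_mult_same_right[of y "x + u" z] inner_mult_same_right[of y x z]
    inner_mult_same_right[of y u z]
  by (simp add: nda_distrib_left inner_add_left inner_add_right inner_commute
      power2_norm_eq_inner algebra_simps)

lemma inner_mult_left: "inner (x * y) z = inner y (cjg x * z)"
  for x y z :: "'k::normed_division_algebra"
  using inner_mult_exchange_left[of x y 1 z]
  by (simp add: cjg_def re_part_def nda_bilinear inner_diff_right algebra_simps)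

lemma inner_mult_right: "inner (y * x) z = inner y (z * cjg x)"
  for x y z :: "'k::normed_division_algebra"
  using inner_mult_exchange_right[of y x z 1]
  by (simp add: cjg_def re_part_def nda_bilinear inner_diff_right algebra_simps)

lemma norm_cjg [simp]: "norm (cjg x) = norm x"
  by (simp add: norm_eq_sqrt_inner inner_cjg_left)

lemma cjg_mult_mult: "cjg x * (x * y) = (norm x)\<^sup>2 *\<^sub>R y"
  for x y :: "'k::normed_division_algebra"
proof -
  have "inner w (cjg x * (x * y)) = inner w ((norm x)\<^sup>2 *\<^sub>R y)" for w
    using inner_mult_left[of x w "x * y"] inner_mult_same_left[of x w y] by simp
  then show ?thesis using vector_eq_ldot by blast
qed

lemma mult_mult_cjg: "(y * x) * cjg x = (norm x)\<^sup>2 *\<^sub>R y"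
  for x y :: "'k::normed_division_algebra"
proof -
  have "inner w ((y * x) * cjg x) = inner w ((norm x)\<^sup>2 *\<^sub>R y)" for w
    using inner_mult_right[of w x "y * x"] inner_mult_same_right[of w x y] by simp
  then show ?thesis using vector_eq_ldot by blast
qed

lemma cjg_mult: "cjg (x * y) = cjg y * cjg x"
  for x y :: "'k::normed_division_algebra"
proof -
  have "inner w (cjg (x * y)) = inner w (cjg y * cjg x)" for w
  proof -
    have "inner w (cjg y * cjg x) = inner (y * w) (cjg x)"
      by (simp add: inner_mult_left)
    also have "\<dots> = inner y (cjg x * cjg w)"
      by (rule inner_mult_right)
    also have "\<dots> = inner (x * y) (cjg w)"
      by (simp add: inner_mult_left)
    also have "\<dots> = inner w (cjg (x * y))"
      by (metis inner_cjg_left inner_commute)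
    finally show ?thesis by simp
  qed
  then show ?thesis using vector_eq_ldot by blast
qed

lemma mult_cjg: "a * cjg a = nrm a *\<^sub>R 1"
  and nrm_eq_norm: "nrm a = (norm a)\<^sup>2"
  using mult_mult_cjg[of 1 a] by (simp_all add: nrm_def re_part_def)

lemma form_eq: "a * cjg b + b * cjg a = form a b *\<^sub>R 1"
  and form_eq_inner: "form a b = 2 * inner a b"
proof -
  have "a * cjg b + b * cjg a = (a + b) * cjg (a + b) - a * cjg a - b * cjg b"
    by (simp add: cjg_add nda_bilinear)
  also have "\<dots> = (nrm (a + b) - nrm a - nrm b) *\<^sub>R 1"
    by (simp add: mult_cjg scaleR_diff_left)
  also have "nrm (a + b) - nrm a - nrm b = 2 * inner a b"
    by (simp add: nrm_eq_norm power2_norm_eq_inner inner_add_left inner_add_right inner_commute)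
  finally have *: "a * cjg b + b * cjg a = (2 * inner a b) *\<^sub>R 1" .
  show "form a b = 2 * inner a b" unfolding form_def * by (simp add: re_part_def)
  then show "a * cjg b + b * cjg a = form a b *\<^sub>R 1" using * by simp
qed


subsection \<open>Cayley-Dickson doubling: quaternions and octonions\<close>

datatype 'a cayley_dickson = CD (cd_fst: 'a) (cd_snd: 'a)

lemma cd_eq_iff: "x = y \<longleftrightarrow> cd_fst x = cd_fst y \<and> cd_snd x = cd_snd y"
  by (metis cayley_dickson.expand)

instantiation cayley_dickson :: (euclidean_space) euclidean_space
begin

definition "0 = CD 0 0"
definition "x + y = CD (cd_fst x + cd_fst y) (cd_snd x + cd_snd y)"
definition "x - y = CD (cd_fst x - cd_fst y) (cd_snd x - cd_snd y)"
definition "- x = CD (- cd_fst x) (- cd_snd x)"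
definition "r *\<^sub>R x = CD (r *\<^sub>R cd_fst x) (r *\<^sub>R cd_snd x)"
definition "inner x y = inner (cd_fst x) (cd_fst y) + inner (cd_snd x) (cd_snd y)"
definition "norm (x::'a cayley_dickson) = sqrt (inner x x)"
definition "dist (x::'a cayley_dickson) y = norm (x - y)"
definition "sgn (x::'a cayley_dickson) = inverse (norm x) *\<^sub>R x"
definition "uniformity =
  (INF e\<in>{0<..}. principal {(x::'a cayley_dickson, y). dist x y < e})"
definition "open (U :: 'a cayley_dickson set) \<longleftrightarrow>
  (\<forall>x\<in>U. \<forall>\<^sub>F (x', y) in uniformity. x' = x \<longrightarrow> y \<in> U)"
definition "Basis = (\<lambda>u. CD u 0) ` Basis \<union> CD 0 ` Basis"

lemmas cd_vector_defs = zero_cayley_dickson_def plus_cayley_dickson_def minus_cayley_dickson_def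
  uminus_cayley_dickson_def scaleR_cayley_dickson_def inner_cayley_dickson_def

instance
proof
  fix u v :: "'a cayley_dickson"
  assume "u \<in> Basis" "v \<in> Basis"
  then show "inner u v = (if u = v then 1 else 0)"
    by (auto simp: Basis_cayley_dickson_def inner_cayley_dickson_def inner_Basis
        dest: nonzero_Basis split: if_splits)
next
  fix x :: "'a cayley_dickson"
  show "(\<forall>u\<in>Basis. inner x u = 0) \<longleftrightarrow> x = 0"
    by (auto simp: Basis_cayley_dickson_def cd_vector_defs ball_Un cd_eq_iff
        euclidean_all_zero_iff)
next
  fix x y z :: "'a cayley_dickson"
  show "inner (x + y) z = inner x z + inner y z"
    by (simp add: cd_vector_defs inner_add_left)
  show "inner x y = inner y x"
    by (simp add: cd_vector_defs inner_commute)
qed (simp_all add: cd_vector_defs cd_eq_iff norm_cayley_dickson_def dist_cayley_dickson_def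
    sgn_cayley_dickson_def uniformity_cayley_dickson_def open_cayley_dickson_def
    Basis_cayley_dickson_def distrib_left scaleR_add_left
    scaleR_add_right add_nonneg_eq_0_iff)

end

lemma DIM_cayley_dickson [simp]:
  "DIM('a::euclidean_space cayley_dickson) = 2 * DIM('a)"
proof -
  have "card ((\<lambda>u. CD u (0::'a)) ` Basis \<union> CD (0::'a) ` Basis)
      = card ((\<lambda>u. CD u (0::'a)) ` Basis) + card (CD (0::'a) ` Basis)"
    by (rule card_Un_disjoint) auto
  then show ?thesis
    by (simp add: Basis_cayley_dickson_def card_image inj_on_def)
qed

lemma norm2_cayley_dickson: "(norm x)\<^sup>2 = (norm (cd_fst x))\<^sup>2 + (norm (cd_snd x))\<^sup>2"
  by (simp add: power2_norm_eq_inner inner_cayley_dickson_def)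

instantiation cayley_dickson :: (normed_division_algebra_assoc) normed_division_algebra
begin

definition "1 = CD 1 0"

definition "x * y =
  CD (cd_fst x * cd_fst y - cjg (cd_snd y) * cd_snd x)
     (cd_snd y * cd_fst x + cd_snd x * cjg (cd_fst y))"

instance
proof
  fix x y :: "'a cayley_dickson"
  obtain a b c d where xy: "x = CD a b" "y = CD c d" by (metis cayley_dickson.exhaust)
  have cross: "inner (a * c) (cjg d * b) = inner (d * a) (b * cjg c)"
    by (metis cjg_cjg inner_commute inner_mult_left inner_mult_right nda_assoc)
  have "(norm (x * y))\<^sup>2 = (norm (a * c - cjg d * b))\<^sup>2 + (norm (d * a + b * cjg c))\<^sup>2"
    by (simp add: xy norm2_cayley_dickson times_cayley_dickson_def)
  also have "\<dots> = (norm (a * c))\<^sup>2 + (norm (cjg d * b))\<^sup>2 + (norm (d * a))\<^sup>2 + (norm (b * cjg c))\<^sup>2"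
    using cross
    by (simp add: power2_norm_eq_inner inner_add_left inner_add_right inner_diff_left
        inner_diff_right inner_commute)
  also have "\<dots> = (norm x)\<^sup>2 * (norm y)\<^sup>2"
    by (simp add: xy norm2_cayley_dickson nda_norm_mult power_mult_distrib algebra_simps)
  finally have "(norm (x * y))\<^sup>2 = (norm x * norm y)\<^sup>2"
    by (simp add: power_mult_distrib)
  then show "norm (x * y) = norm x * norm y" by simp
qed (simp_all add: times_cayley_dickson_def one_cayley_dickson_def cd_vector_defs cd_eq_iff
    nda_bilinear cjg_def re_part_def inner_add_left scaleR_2 algebra_simps)

end

lemma cjg_cayley_dickson [simp]: "cjg (CD a b) = CD (cjg a) (- b)"
  by (simp add: cjg_def re_part_def one_cayley_dickson_def cd_vector_defs)

lemma cjg_mult_comm: "cjg (x * y) = cjg x * cjg (y :: 'k::normed_division_algebra_comm)"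
  by (simp add: cjg_mult nda_commute)

lemma nda_left_commute: "a * (b * c) = b * (a * (c :: 'k::normed_division_algebra_comm))"
  by (metis nda_assoc nda_commute)

instance cayley_dickson :: (normed_division_algebra_comm) normed_division_algebra_assoc
  by standard
    (simp add: times_cayley_dickson_def cd_eq_iff nda_bilinear cjg_mult_comm cjg_add cjg_diff
      nda_assoc nda_left_commute nda_commute algebra_simps)

type_synonym quaternion = "complex cayley_dickson"
type_synonym octonion = "quaternion cayley_dickson"

lemma DIM_quaternion: "DIM(quaternion) = 4" and DIM_octonion: "DIM(octonion) = 8"
  by simp_all


section \<open>Finite root systems\<close>

definition root_system :: "'v::euclidean_space set \<Rightarrow> bool" where
  "root_system \<Phi> \<longleftrightarrow>
     finite \<Phi> \<and> 0 \<notin> \<Phi> \<and> span \<Phi> = UNIV \<and>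
     (\<forall>\<alpha>\<in>\<Phi>. \<forall>c. c *\<^sub>R \<alpha> \<in> \<Phi> \<longrightarrow> c = 1 \<or> c = -1) \<and>
     (\<forall>\<alpha>\<in>\<Phi>. \<forall>\<beta>\<in>\<Phi>. 2 * inner \<beta> \<alpha> / inner \<alpha> \<alpha> \<in> \<int> \<and>
        \<beta> - (2 * inner \<beta> \<alpha> / inner \<alpha> \<alpha>) *\<^sub>R \<alpha> \<in> \<Phi>)"

definition root_base :: "'v::euclidean_space set \<Rightarrow> (nat \<Rightarrow> 'v) \<Rightarrow> bool" where
  "root_base \<Phi> b \<longleftrightarrow>
     inj_on b {1..DIM('v)} \<and> b ` {1..DIM('v)} \<subseteq> \<Phi> \<and> independent (b ` {1..DIM('v)}) \<and>
     (\<forall>\<beta>\<in>\<Phi>. \<exists>n::nat \<Rightarrow> nat. \<beta> = (\<Sum>i = 1..DIM('v). real (n i) *\<^sub>R b i) \<or>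
        \<beta> = - (\<Sum>i = 1..DIM('v). real (n i) *\<^sub>R b i))"

text \<open>A finite root system of rank \<open>DIM('k)\<close> lives in a Euclidean space of that dimension, so the
  type \<open>'k\<close> itself can serve as the ambient space. Only its Cartan matrix matters here.\<close>

definition simple_roots_of_finite_type :: "(nat \<Rightarrow> 'k::normed_division_algebra) \<Rightarrow> bool" where
  "simple_roots_of_finite_type a \<longleftrightarrow>
     (\<exists>(\<Phi>::'k set) b. root_system \<Phi> \<and> root_base \<Phi> b \<and>
        (\<forall>i\<in>{1..DIM('k)}. \<forall>j\<in>{1..DIM('k)}.
           2 * form (a i) (a j) / form (a j) (a j) = 2 * inner (b i) (b j) / inner (b j) (b j)))"

lemma root_base_simple_roots_of_finite_type:
  "root_system \<Phi> \<Longrightarrow> root_base \<Phi> a \<Longrightarrow> simple_roots_of_finite_type a"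
  unfolding simple_roots_of_finite_type_def form_eq_inner by (intro exI[of _ \<Phi>] exI[of _ a]) simp

text \<open>The root system with simple roots \<open>a\<close>: every root is a Weyl group image of a simple root.\<close>

inductive_set roots :: "(nat \<Rightarrow> 'k::normed_division_algebra) \<Rightarrow> 'k set" for a where
  simple: "i \<in> {1..DIM('k)} \<Longrightarrow> a i \<in> roots a"
| reflect: "\<beta> \<in> roots a \<Longrightarrow> i \<in> {1..DIM('k)} \<Longrightarrow>
    \<beta> - (2 * form \<beta> (a i) / form (a i) (a i)) *\<^sub>R a i \<in> roots a"

text \<open>The highest root is the maximum, not merely a maximal element, of the root order, so it exists
  exactly when the root system is irreducible.\<close>

definition highest_root :: "(nat \<Rightarrow> 'k::normed_division_algebra) \<Rightarrow> 'k \<Rightarrow> bool" where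
  "highest_root a \<theta> \<longleftrightarrow> \<theta> \<in> roots a \<and>
     (\<forall>\<beta>\<in>roots a. \<exists>n::nat \<Rightarrow> nat. \<theta> - \<beta> = (\<Sum>i = 1..DIM('k). real (n i) *\<^sub>R a i))"

definition root_lattice :: "(nat \<Rightarrow> 'k::normed_division_algebra) \<Rightarrow> 'k set" where
  "root_lattice a = {\<Sum>i = 1..DIM('k). real_of_int (n i) *\<^sub>R a i | n. True}"


section \<open>Two by two matrices\<close>

definition mat2 :: "'k \<Rightarrow> 'k \<Rightarrow> 'k \<Rightarrow> 'k \<Rightarrow> 'k::zero^2^2" where
  "mat2 p q r s = vector [vector [p, q], vector [r, s]]"

text \<open>The library's matrix product requires an associative ring of entries.\<close>

definition mat_times ::
    "'k::normed_division_algebra^2^2 \<Rightarrow> 'k^2^2 \<Rightarrow> 'k^2^2" (infixl \<open>\<star>\<close> 70) where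
  "A \<star> B = (\<chi> i j. \<Sum>k\<in>UNIV. A $ i $ k * B $ k $ j)"

definition dagger :: "'k::normed_division_algebra^2^2 \<Rightarrow> 'k^2^2" where
  "dagger A = (\<chi> i j. cjg (A $ j $ i))"

lemma mat2_nth [simp]:
  "mat2 p q r s $ 1 $ 1 = p" "mat2 p q r s $ 1 $ 2 = q"
  "mat2 p q r s $ 2 $ 1 = r" "mat2 p q r s $ 2 $ 2 = s"
  by (simp_all add: mat2_def)

lemma mat2_mult:
  "mat2 a b c d \<star> mat2 p q r s
    = mat2 (a * p + b * r) (a * q + b * s) (c * p + d * r) (c * q + d * s)"
  by (simp add: mat_times_def vec_eq_iff forall_2 sum_2)

lemma dagger_mat2: "dagger (mat2 p q r s) = mat2 (cjg p) (cjg r) (cjg q) (cjg s)"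
  by (simp add: dagger_def vec_eq_iff forall_2)

definition hermitian :: "('k::normed_division_algebra^2^2) set" where
  "hermitian = {X. dagger X = X}"

definition herm :: "real \<Rightarrow> 'k \<Rightarrow> real \<Rightarrow> 'k::normed_division_algebra^2^2" where
  "herm p z m = mat2 (p *\<^sub>R 1) z (cjg z) (m *\<^sub>R 1)"

text \<open>Meaningful on Hermitian matrices only, where the expression inside \<open>re_part\<close> is a real
  multiple of \<open>1\<close>; see \<open>hdet_herm\<close>.\<close>

definition hdet :: "'k::normed_division_algebra^2^2 \<Rightarrow> real" where
  "hdet X = re_part (X $ 1 $ 1 * X $ 2 $ 2 - X $ 1 $ 2 * X $ 2 $ 1)"

definition hnorm2 :: "'k::normed_division_algebra^2^2 \<Rightarrow> real" where
  "hnorm2 X = - 2 * hdet X"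

definition hform :: "'k::normed_division_algebra^2^2 \<Rightarrow> 'k^2^2 \<Rightarrow> real" where
  "hform X Y = (hnorm2 (X + Y) - hnorm2 X - hnorm2 Y) / 2"

lemma cjg_scaleR_one [simp]: "cjg (r *\<^sub>R 1) = (r *\<^sub>R 1 :: 'a::normed_division_algebra)"
  by (simp add: cjg_def re_part_def flip: scaleR_diff_left)

lemma cjg_eq_iff: "cjg x = x \<longleftrightarrow> x = re_part x *\<^sub>R 1"
  for x :: "'a::normed_division_algebra"
proof
  assume "cjg x = x"
  then have "2 *\<^sub>R x = 2 *\<^sub>R (re_part x *\<^sub>R 1)"
    by (simp add: cjg_def scaleR_2 diff_eq_eq)
  then show "x = re_part x *\<^sub>R 1"
    by (metis scaleR_cancel_left zero_neq_numeral)
next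
  assume x: "x = re_part x *\<^sub>R 1"
  show "cjg x = x" by (metis x cjg_scaleR_one)
qed

lemma hermitian_eq: "(hermitian :: ('a::normed_division_algebra^2^2) set) = {herm p z m | p z m. True}"
proof (intro set_eqI iffI)
  fix X :: "'a^2^2" assume "X \<in> hermitian"
  then have "\<forall>i j. cjg (X $ j $ i) = X $ i $ j"
    by (simp add: hermitian_def dagger_def vec_eq_iff)
  then have "X = herm (re_part (X $ 1 $ 1)) (X $ 1 $ 2) (re_part (X $ 2 $ 2))"
    by (auto simp: herm_def vec_eq_iff forall_2 cjg_eq_iff[symmetric] simp flip: cjg_eq_iff)
  then show "X \<in> {herm p z m | p z m. True}" by blast
qed (auto simp: hermitian_def herm_def dagger_mat2 cjg_eq_iff re_part_def)

lemma hdet_herm: "hdet (herm p z m) = p * m - nrm z"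
  by (simp add: hdet_def herm_def nda_bilinear mult_cjg re_part_def inner_diff_left)


section \<open>The hyperbolic root lattice and its reflections\<close>

definition hyp_lattice :: "(nat \<Rightarrow> 'k) \<Rightarrow> ('k::normed_division_algebra^2^2) set" where
  "hyp_lattice a = {X \<in> hermitian. \<exists>p m :: int. \<exists>z \<in> root_lattice a. X = herm p z m}"

definition simple_root ::
    "(nat \<Rightarrow> 'k) \<Rightarrow> 'k \<Rightarrow> int \<Rightarrow> 'k::normed_division_algebra^2^2" where
  "simple_root a \<theta> I =
     (if I = -1 then mat2 1 0 0 (- 1)
      else if I = 0 then mat2 (- 1) (- \<theta>) (- cjg \<theta>) 0
      else mat2 0 (a (nat I)) (cjg (a (nat I))) 0)"

definition simple_refl ::
    "(nat \<Rightarrow> 'k) \<Rightarrow> 'k \<Rightarrow> int \<Rightarrow> 'k^2^2 \<Rightarrow> 'k::normed_division_algebra^2^2" where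
  "simple_refl a \<theta> I X =
     X - (2 * hform X (simple_root a \<theta> I) / hform (simple_root a \<theta> I) (simple_root a \<theta> I))
           *\<^sub>R simple_root a \<theta> I"

definition double_refl ::
    "(nat \<Rightarrow> 'k) \<Rightarrow> 'k \<Rightarrow> nat \<Rightarrow> 'k^2^2 \<Rightarrow> 'k::normed_division_algebra^2^2" where
  "double_refl a \<theta> I = simple_refl a \<theta> (-1) \<circ> simple_refl a \<theta> (int I)"

definition unit_root :: "(nat \<Rightarrow> 'k) \<Rightarrow> nat \<Rightarrow> 'k::normed_division_algebra" where
  "unit_root a i = (1 / sqrt (nrm (a i))) *\<^sub>R a i"

definition S_mat :: "(nat \<Rightarrow> 'k) \<Rightarrow> 'k \<Rightarrow> nat \<Rightarrow> 'k::normed_division_algebra^2^2" where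
  "S_mat a \<theta> I =
     (if I = 0 then mat2 0 \<theta> (- cjg \<theta>) 1
      else mat2 0 (- unit_root a I) (cjg (unit_root a I)) 0)"

end

theory Submission
  imports Defs
begin

text \<open>
  Both kinds of double reflection are instances of one formula. For a unit \<open>u \<in> \<bbbK>\<close> and a real
  \<open>c\<close>, let \<open>\<beta>\<close> be the Hermitian matrix with diagonal \<open>(-c, 0)\<close> and upper right entry \<open>-u\<close>, and
  let \<open>S\<close> have rows \<open>(0, u)\<close> and \<open>(-cjg u, c)\<close>. Then \<open>w\<^bsub>-1\<^esub>\<close> after the reflection in \<open>\<beta>\<close> sends
  every Hermitian \<open>X\<close> to \<open>S X S\<^sup>\<dagger>\<close> (\<open>hrefl_unit\<close>, \<open>conjugation_unit\<close>).
  The affine root is the case \<open>u = \<theta>\<close>, \<open>c = 1\<close>. For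
  \<open>u = -\<epsilon>\<^sub>i\<close>, \<open>c = 0\<close> the matrix \<open>\<beta>\<close> is a positive multiple of \<open>\<alpha>\<^sub>i\<close>, and a reflection depends only
  on the line spanned by its root.

  The reflection \<open>w\<^bsub>-1\<^esub>\<close> just interchanges the two diagonal entries, so the formula is a
  comparison of entries. All of it is immediate except the off-diagonal entry, which
  contains \<open>u z\<^sup>* u\<close>, where \<open>z\<^sup>*\<close> denotes the conjugate of \<open>z\<close>. There the identity
  \<open>u z\<^sup>* u = (z,u) u - N(u) z\<close> (\<open>sandwich_left\<close>, \<open>sandwich_right\<close>) converts multiplication into
  the negative of the reflection of \<open>z\<close> in \<open>u\<close>, for a unit \<open>u\<close>. It follows
  from \<open>u z\<^sup>* + z u\<^sup>* = (z,u)\<close> upon multiplying by \<open>u\<close> on the right, and from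
  \<open>z\<^sup>* u + u\<^sup>* z = (z,u)\<close> upon multiplying by \<open>u\<close> on the left. These yield the two
  bracketings. The remaining products \<open>(z u\<^sup>*) u\<close> and \<open>u (u\<^sup>* z)\<close> both equal \<open>N(u) z\<close> in every
  composition algebra, so the argument covers the octonions as well.
\<close>

lemma form_cjg: "form (cjg x) (cjg y) = form x y"
  by (simp add: form_eq_inner inner_cjg_left)

lemma cjg_scaleR: "cjg (r *\<^sub>R x) = r *\<^sub>R cjg x"
  by (simp add: cjg_def re_part_def algebra_simps)

lemma cjg_zero [simp]: "cjg 0 = 0"
  by (simp add: cjg_def re_part_def)

lemma cjg_mult_self: "cjg u * u = nrm u *\<^sub>R 1"
  using mult_cjg[of "cjg u"] by (simp add: nrm_eq_norm)

lemma sandwich_left: "(u * cjg z) * u = form z u *\<^sub>R u - nrm u *\<^sub>R z"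
proof -
  have "u * cjg z = form z u *\<^sub>R 1 - z * cjg u"
    using form_eq[of z u] by (simp add: algebra_simps)
  then show ?thesis
    using mult_mult_cjg[of z "cjg u"] by (simp add: nda_bilinear nrm_eq_norm)
qed

lemma sandwich_right: "u * (cjg z * u) = form z u *\<^sub>R u - nrm u *\<^sub>R z"
proof -
  have "cjg z * u = form z u *\<^sub>R 1 - cjg u * z"
    using form_eq[of "cjg z" "cjg u"] by (simp add: form_cjg algebra_simps)
  then show ?thesis
    using cjg_mult_mult[of "cjg u" z] by (simp add: nda_bilinear nrm_eq_norm)
qed

lemma herm_add: "herm p z m + herm p' z' m' = herm (p + p') (z + z') (m + m')"
  by (simp add: herm_def vec_eq_iff forall_2 cjg_add scaleR_add_left)

lemma herm_scaleR: "r *\<^sub>R herm p z m = herm (r * p) (r *\<^sub>R z) (r * m)"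
  by (simp add: herm_def vec_eq_iff forall_2 cjg_scaleR)

lemma herm_diff: "herm p z m - herm p' z' m' = herm (p - p') (z - z') (m - m')"
  by (simp add: herm_def vec_eq_iff forall_2 cjg_diff scaleR_diff_left)

lemma hform_herm: "hform (herm p z m) (herm p' z' m') = form z z' - p * m' - p' * m"
  by (simp add: hform_def hnorm2_def herm_add hdet_herm nrm_eq_norm form_eq_inner
      power2_norm_eq_inner inner_add_left inner_add_right inner_commute field_simps)

definition hrefl :: "'k^2^2 \<Rightarrow> 'k^2^2 \<Rightarrow> 'k::normed_division_algebra^2^2" where
  "hrefl \<alpha> X = X - (2 * hform X \<alpha> / hform \<alpha> \<alpha>) *\<^sub>R \<alpha>"

lemma simple_refl_eq_hrefl: "simple_refl a \<theta> I = hrefl (simple_root a \<theta> I)"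
  by (simp add: simple_refl_def hrefl_def fun_eq_iff)

lemma hrefl_herm_scaleR:
  assumes "r \<noteq> 0"
  shows "hrefl (r *\<^sub>R herm p z m) (herm p' z' m') = hrefl (herm p z m) (herm p' z' m')"
proof -
  let ?\<alpha> = "herm p z m" and ?X = "herm p' z' m'"
  have "hform ?X (r *\<^sub>R ?\<alpha>) = r * hform ?X ?\<alpha>"
    and "hform (r *\<^sub>R ?\<alpha>) (r *\<^sub>R ?\<alpha>) = r * (r * hform ?\<alpha> ?\<alpha>)"
    by (simp_all add: herm_scaleR hform_herm form_eq_inner algebra_simps)
  then show ?thesis using assms by (simp add: hrefl_def)
qed

lemma simple_refl_minus_one: "simple_refl a \<theta> (-1) (herm p z m) = herm m z p"
proof -
  have root: "simple_root a \<theta> (-1) = herm 1 0 (-1)"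
    by (simp add: simple_root_def herm_def)
  show ?thesis
    by (simp add: simple_refl_def root hform_herm herm_scaleR herm_diff form_eq_inner
        field_simps)
qed

lemma hrefl_unit:
  assumes "nrm u = 1"
  shows "hrefl (herm (- c) (- u) 0) (herm p z m)
    = herm (p + c * (c * m - form z u)) (z + (c * m - form z u) *\<^sub>R u) m"
proof -
  have "form (- u) (- u) = 2" and "form z (- u) = - form z u"
    using assms by (simp_all add: form_eq_inner nrm_eq_norm power2_norm_eq_inner)
  then have coeff: "2 * hform (herm p z m) (herm (- c) (- u) 0)
      / hform (herm (- c) (- u) 0) (herm (- c) (- u) 0) = c * m - form z u"
    by (simp add: hform_herm)
  show ?thesis
    unfolding hrefl_def coeff by (simp add: herm_scaleR herm_diff algebra_simps)
qed

text \<open>Both products are the value of \<open>hrefl_unit\<close> with the diagonal entries interchanged. The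
  sandwich identities match the upper right entries in both bracketings; the lower right entry uses
  that \<open>z\<^sup>* u + u\<^sup>* z\<close> is the real number \<open>(z,u)\<close>.\<close>

lemma conjugation_unit:
  fixes u :: "'k::normed_division_algebra" and c :: real
  assumes "nrm u = 1"
  defines "S \<equiv> mat2 0 u (- cjg u) (c *\<^sub>R 1)"
  shows "(S \<star> herm p z m) \<star> dagger S
      = herm m (z + (c * m - form z u) *\<^sub>R u) (p + c * (c * m - form z u))" (is ?left)
    and "S \<star> (herm p z m \<star> dagger S)
      = herm m (z + (c * m - form z u) *\<^sub>R u) (p + c * (c * m - form z u))" (is ?right)
proof -
  have dag: "dagger S = mat2 0 (- u) (cjg u) (c *\<^sub>R 1)"
    by (simp add: S_def dagger_mat2 cjg_minus)
  have unit: "u * cjg u = 1" "cjg u * u = 1"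
    using assms(1) by (simp_all add: mult_cjg cjg_mult_self)
  have cross: "cjg u * z = form z u *\<^sub>R 1 - cjg z * u"
    using form_eq[of "cjg z" "cjg u"] by (simp add: form_cjg algebra_simps)
  have up: "(u * cjg z) * u = form z u *\<^sub>R u - z" "u * (cjg z * u) = form z u *\<^sub>R u - z"
    using assms(1) by (simp_all add: sandwich_left sandwich_right)
  \<comment> \<open>The lower left entries are the conjugates of the upper right ones, with the bracketing
    interchanged.\<close>
  have low: "(cjg u * z) * cjg u = form z u *\<^sub>R cjg u - cjg z"
    "cjg u * (z * cjg u) = form z u *\<^sub>R cjg u - cjg z"
    using arg_cong[OF up(2), of cjg] arg_cong[OF up(1), of cjg]
    by (simp_all add: cjg_mult cjg_diff cjg_scaleR)
  show ?left
    unfolding dag unfolding S_def herm_def mat2_mult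
    by (simp add: vec_eq_iff forall_2 nda_bilinear unit up low cjg_add cjg_diff cjg_scaleR)
      (simp add: cross algebra_simps)
  show ?right
    unfolding dag unfolding S_def herm_def mat2_mult
    by (simp add: vec_eq_iff forall_2 nda_bilinear unit up low cjg_add cjg_diff cjg_scaleR)
      (simp add: cross algebra_simps)
qed

lemma double_refl_eq_conjugation:
  fixes u :: "'k::normed_division_algebra"
  assumes "nrm u = 1" "r \<noteq> 0"
    and "simple_root a \<theta> (int I) = r *\<^sub>R herm (- c) (- u) 0"
    and "S_mat a \<theta> I = mat2 0 u (- cjg u) (c *\<^sub>R 1)"
  shows "double_refl a \<theta> I (herm p z m) = (S_mat a \<theta> I \<star> herm p z m) \<star> dagger (S_mat a \<theta> I)"
    and "double_refl a \<theta> I (herm p z m) = S_mat a \<theta> I \<star> (herm p z m \<star> dagger (S_mat a \<theta> I))"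
proof -
  have "simple_refl a \<theta> (int I) (herm p z m)
      = herm (p + c * (c * m - form z u)) (z + (c * m - form z u) *\<^sub>R u) m"
    by (simp only: simple_refl_eq_hrefl assms(3) hrefl_herm_scaleR[OF assms(2)]
        hrefl_unit[OF assms(1)])
  then have "double_refl a \<theta> I (herm p z m)
      = herm m (z + (c * m - form z u) *\<^sub>R u) (p + c * (c * m - form z u))"
    by (simp add: double_refl_def simple_refl_minus_one)
  then show "double_refl a \<theta> I (herm p z m) = (S_mat a \<theta> I \<star> herm p z m) \<star> dagger (S_mat a \<theta> I)"
    and "double_refl a \<theta> I (herm p z m) = S_mat a \<theta> I \<star> (herm p z m \<star> dagger (S_mat a \<theta> I))"
    by (simp_all only: assms(4) conjugation_unit[OF assms(1)])
qed

text \<open>The diagonal entries of a Cartan matrix are \<open>2\<close>, whereas the quotient defining such an entry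
  would be \<open>0 / 0 = 0\<close> for a vanishing root.\<close>

lemma simple_root_nonzero:
  fixes a :: "nat \<Rightarrow> 'k::normed_division_algebra"
  assumes "simple_roots_of_finite_type a" "i \<in> {1..DIM('k)}"
  shows "a i \<noteq> 0"
proof
  assume zero: "a i = 0"
  obtain \<Phi> :: "'k set" and b where "root_system \<Phi>" "root_base \<Phi> b"
    and cartan: "\<forall>i\<in>{1..DIM('k)}. \<forall>j\<in>{1..DIM('k)}.
      2 * form (a i) (a j) / form (a j) (a j) = 2 * inner (b i) (b j) / inner (b j) (b j)"
    using assms(1) unfolding simple_roots_of_finite_type_def by (elim exE conjE)
  then have "b i \<in> \<Phi>" "0 \<notin> \<Phi>"
    using assms(2) by (simp_all add: root_system_def root_base_def image_subset_iff)
  then have "b i \<noteq> 0" by metis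
  then show False
    using cartan[rule_format, OF assms(2) assms(2)] zero by (simp add: form_eq_inner)
qed

theorem theorem2:
  fixes a :: "nat \<Rightarrow> 'k::normed_division_algebra" and \<theta> :: 'k
  assumes "simple_roots_of_finite_type a"
    and "highest_root a \<theta>"
    and "\<theta> * cjg \<theta> = 1"
  shows "\<forall>X \<in> hyp_lattice a. \<forall>I \<in> {0..DIM('k)}.
    double_refl a \<theta> I X = (S_mat a \<theta> I \<star> X) \<star> dagger (S_mat a \<theta> I) \<and>
    double_refl a \<theta> I X = S_mat a \<theta> I \<star> (X \<star> dagger (S_mat a \<theta> I))"
proof (intro ballI)
  fix X :: "'k^2^2" and I :: nat
  assume X: "X \<in> hyp_lattice a" and I: "I \<in> {0..DIM('k)}"
  from X obtain p z m where Xeq: "X = herm p z m"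
    unfolding hyp_lattice_def by blast
  show "double_refl a \<theta> I X = (S_mat a \<theta> I \<star> X) \<star> dagger (S_mat a \<theta> I) \<and>
      double_refl a \<theta> I X = S_mat a \<theta> I \<star> (X \<star> dagger (S_mat a \<theta> I))"
  proof (cases "I = 0")
    case True
    have unit: "nrm \<theta> = 1"
      using assms(3) by (simp add: nrm_def re_part_def)
    have root: "simple_root a \<theta> (int I) = 1 *\<^sub>R herm (- 1) (- \<theta>) 0"
      using True by (simp add: simple_root_def herm_def cjg_minus)
    have S: "S_mat a \<theta> I = mat2 0 \<theta> (- cjg \<theta>) (1 *\<^sub>R 1)"
      using True by (simp add: S_mat_def)
    show ?thesis
      unfolding Xeq
      by (intro conjI double_refl_eq_conjugation[OF unit one_neq_zero root S])
  next
    case False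
    define r where "r = norm (a I)"
    define u where "u = - unit_root a I"
    have r: "r \<noteq> 0"
      using simple_root_nonzero[OF assms(1), of I] I False by (simp add: r_def)
    have u: "u = - ((1 / r) *\<^sub>R a I)"
      by (simp add: u_def unit_root_def r_def nrm_eq_norm)
    have unit: "nrm u = 1"
      using r by (simp add: nrm_eq_norm u r_def)
    have root: "simple_root a \<theta> (int I) = r *\<^sub>R herm (- 0) (- u) 0"
      unfolding herm_scaleR using r False by (simp add: simple_root_def herm_def u)
    have S: "S_mat a \<theta> I = mat2 0 u (- cjg u) (0 *\<^sub>R 1)"
      using False by (simp add: S_mat_def u_def cjg_minus)
    show ?thesis
      unfolding Xeq
      by (intro conjI double_refl_eq_conjugation[OF unit r root S])
  qed
qed

end
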